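(* Let $\gamma>-1$, $0\le\mu<\gamma+1$, $0<\lambda\le\Lambda$, let $F,\mathfrak b,\lambda_0$ be as in the context with $\Omega=B_1\subset\mathbb{R}^N$, and let $u$ be a nonnegative, bounded viscosity solution of $$F(x,Du,D^2u)+|Du|^{\gamma}\langle \mathfrak b(x),Du\rangle=\lambda_0(x)\,u^{\mu}\chi_{\{u>0\}}(x)\quad\text{in } B_1 .$$ Let $x_0\in\overline{\{u>0\}}\cap B_{1/2}$. Then for every $0<r<\tfrac12$, $$\sup_{B_r(x_0)}u\ \ge\ C_{\sharp}\; r^{\frac{\gamma+2}{\gamma+1-\mu}},$$ where $C_\sharp>0$ is a constant depending only on $N,\Lambda,\inf_{\Omega}\lambda_0,\gamma,\mu$.
   Context: $B_r(x)$ is the open ball of radius $r$ centred at $x$ in $\mathbb{R}^N$, $B_r=B_r(0)$; $\mathrm{Sym}(N)$ is the space of real symmetric $N\times N$ matrices. Data: $\Omega\subset\mathbb{R}^N$ is a smooth bounded domain (here $B_1$); $\mathfrak b\in C^0(\overline\Omega,\mathbb{R}^N)$; $\lambda_0\in C^0(\overline\Omega)$ is bounded away from zero and infinity ($0<\inf\lambda_0\le\sup\lambda_0<\infty$); $F:\Omega\times(\mathbb{R}^N\setminus\{0\})\times \mathrm{Sym}(N)\to\mathbb{R}$ is continuous and satisfies: (F1) for all $x\in\Omega$, $p\in\mathbb{R}^N\setminus\{0\}$, $M,P\in \mathrm{Sym}(N)$ with $P\ge0$: $|p|^\gamma\mathcal P^-_{\lambda,\Lambda}(P)\le F(x,p,M+P)-F(x,p,M)\le|p|^\gamma\mathcal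 P^+_{\lambda,\Lambda}(P)$, where, with $e_i$ the eigenvalues of $M$, $\mathcal P^+_{\lambda,\Lambda}(M)=\lambda\sum_{e_i<0}e_i+\Lambda\sum_{e_i>0}e_i$ and $\mathcal P^-_{\lambda,\Lambda}(M)=\lambda\sum_{e_i>0}e_i+\Lambda\sum_{e_i<0}e_i$; (F2) $F(x,sp,M)=|s|^\gamma F(x,p,M)$ for all $s\in\mathbb{R}\setminus\{0\}$, $x\in\Omega$, $p\in\mathbb{R}^N\setminus\{0\}$, $M\in \mathrm{Sym}(N)$. Write $G(x,p,M)=F(x,p,M)+|p|^\gamma\langle\mathfrak b(x),p\rangle$. Viscosity solutions: $u\in C^0(\Omega)$ is a viscosity super-solution (resp. sub-solution) of $G(x,Du,D^2u)=f(x,u)$ in $\Omega$ if for each $x_0\in\Omega$: if $u$ is constant, $u=K$, on some ball $B_\varepsilon(x_0)\subset\Omega$, then $f(x,K)\ge0$ (resp. $\le0$) for all $x\in B_\varepsilon(x_0)$; otherwise, for every $\phi\in C^2(\Omega)$ such that $u-\phi$ has a local minimum (resp. maximum) at $x_0$ and $D\phi(x_0)\ne0$, $G(x_0,D\phi(x_0),D^2\phi(x_0))\le f(x_0,u(x_0))$ (resp. $\ge$). A viscosity solution is both. Here $f(x,u)=\lambda_0(x)u^\mu\chi_{\{u>0\}}$.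
   Formalization: The formal theorem also assumes F(x,p,0)=0 for all x in B_1 and p≠0, and lets the constant C_♯ depend on sup|b| over B_1 in addition to N, Λ, inf λ_0, γ, μ; the statement fails without either change. *)

theory Defs
  imports "HOL-Analysis.Analysis"
begin

definition Sym :: "(real^'n^'n) set"
  where "Sym = {M. transpose M = M}"

definition psd :: "real^'n^'n \<Rightarrow> bool"
  where "psd P \<longleftrightarrow> (\<forall>v. 0 \<le> v \<bullet> (P *v v))"

definition eigenvalues :: "real^'n^'n \<Rightarrow> real set"
  where "eigenvalues M = {e. \<exists>v. v \<noteq> 0 \<and> M *v v = e *\<^sub>R v}"

(* For symmetric matrices, the only ones used below, this is also the algebraic multiplicity. *)
definition eig_mult :: "real^'n^'n \<Rightarrow> real \<Rightarrow> nat"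
  where "eig_mult M e = dim {v. M *v v = e *\<^sub>R v}"

(* The Pucci sums run over the eigenvalues repeated according to multiplicity; eigenvalues M
   collects the distinct ones, hence the factor eig_mult. *)
definition pos_eig_sum :: "real^'n^'n \<Rightarrow> real"
  where "pos_eig_sum M = (\<Sum>e \<in> {e \<in> eigenvalues M. 0 < e}. real (eig_mult M e) * e)"

definition neg_eig_sum :: "real^'n^'n \<Rightarrow> real"
  where "neg_eig_sum M = (\<Sum>e \<in> {e \<in> eigenvalues M. e < 0}. real (eig_mult M e) * e)"

definition Pucci_plus :: "real \<Rightarrow> real \<Rightarrow> real^'n^'n \<Rightarrow> real"
  where "Pucci_plus lam Lam M = lam * neg_eig_sum M + Lam * pos_eig_sum M"

definition Pucci_minus :: "real \<Rightarrow> real \<Rightarrow> real^'n^'n \<Rightarrow> real"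
  where "Pucci_minus lam Lam M = lam * pos_eig_sum M + Lam * neg_eig_sum M"

definition continuous_operator ::
    "(real^'n) set \<Rightarrow> (real^'n \<Rightarrow> real^'n \<Rightarrow> real^'n^'n \<Rightarrow> real) \<Rightarrow> bool"
  where "continuous_operator \<Omega> F \<longleftrightarrow>
    continuous_on (\<Omega> \<times> (UNIV - {0}) \<times> Sym) (\<lambda>(x, p, M). F x p M)"

definition F1 ::
    "(real^'n) set \<Rightarrow> real \<Rightarrow> real \<Rightarrow> real \<Rightarrow> (real^'n \<Rightarrow> real^'n \<Rightarrow> real^'n^'n \<Rightarrow> real) \<Rightarrow> bool"
  where "F1 \<Omega> \<gamma> lam Lam F \<longleftrightarrow>
    (\<forall>x\<in>\<Omega>. \<forall>p. p \<noteq> 0 \<longrightarrow> (\<forall>M\<in>Sym. \<forall>P\<in>Sym. psd P \<longrightarrow>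
       norm p powr \<gamma> * Pucci_minus lam Lam P \<le> F x p (M + P) - F x p M \<and>
       F x p (M + P) - F x p M \<le> norm p powr \<gamma> * Pucci_plus lam Lam P))"

definition F2 ::
    "(real^'n) set \<Rightarrow> real \<Rightarrow> (real^'n \<Rightarrow> real^'n \<Rightarrow> real^'n^'n \<Rightarrow> real) \<Rightarrow> bool"
  where "F2 \<Omega> \<gamma> F \<longleftrightarrow>
    (\<forall>s. s \<noteq> 0 \<longrightarrow> (\<forall>x\<in>\<Omega>. \<forall>p. p \<noteq> 0 \<longrightarrow> (\<forall>M\<in>Sym.
       F x (s *\<^sub>R p) M = \<bar>s\<bar> powr \<gamma> * F x p M)))"

(* On an open set, g and H are uniquely determined by phi: gradient and Hessian. *)
definition C2_with ::
    "(real^'n) set \<Rightarrow> (real^'n \<Rightarrow> real) \<Rightarrow> (real^'n \<Rightarrow> real^'n) \<Rightarrow> (real^'n \<Rightarrow> real^'n^'n) \<Rightarrow> bool"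
  where "C2_with \<Omega> \<phi> g H \<longleftrightarrow>
    (\<forall>x\<in>\<Omega>. GDERIV \<phi> x :> g x) \<and>
    (\<forall>x\<in>\<Omega>. (g has_derivative (\<lambda>h. H x *v h)) (at x)) \<and>
    continuous_on \<Omega> H"

definition const_on_ball ::
    "(real^'n) set \<Rightarrow> (real^'n \<Rightarrow> real) \<Rightarrow> real^'n \<Rightarrow> real \<Rightarrow> real \<Rightarrow> bool"
  where "const_on_ball \<Omega> u x0 \<epsilon> K \<longleftrightarrow>
    0 < \<epsilon> \<and> ball x0 \<epsilon> \<subseteq> \<Omega> \<and> (\<forall>x\<in>ball x0 \<epsilon>. u x = K)"

definition viscosity_supersolution ::
    "(real^'n) set \<Rightarrow> (real^'n \<Rightarrow> real^'n \<Rightarrow> real^'n^'n \<Rightarrow> real) \<Rightarrow> (real^'n \<Rightarrow> real \<Rightarrow> real) \<Rightarrow>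
     (real^'n \<Rightarrow> real) \<Rightarrow> bool"
  where "viscosity_supersolution \<Omega> G f u \<longleftrightarrow>
    continuous_on \<Omega> u \<and>
    (\<forall>x0\<in>\<Omega>.
      (\<forall>\<epsilon> K. const_on_ball \<Omega> u x0 \<epsilon> K \<longrightarrow> (\<forall>x\<in>ball x0 \<epsilon>. 0 \<le> f x K)) \<and>
      ((\<nexists>\<epsilon> K. const_on_ball \<Omega> u x0 \<epsilon> K) \<longrightarrow>
        (\<forall>\<phi> g H. C2_with \<Omega> \<phi> g H \<longrightarrow>
           (\<forall>\<^sub>F x in nhds x0. u x0 - \<phi> x0 \<le> u x - \<phi> x) \<longrightarrow> g x0 \<noteq> 0 \<longrightarrow>
           G x0 (g x0) (H x0) \<le> f x0 (u x0))))"

definition viscosity_subsolution ::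
    "(real^'n) set \<Rightarrow> (real^'n \<Rightarrow> real^'n \<Rightarrow> real^'n^'n \<Rightarrow> real) \<Rightarrow> (real^'n \<Rightarrow> real \<Rightarrow> real) \<Rightarrow>
     (real^'n \<Rightarrow> real) \<Rightarrow> bool"
  where "viscosity_subsolution \<Omega> G f u \<longleftrightarrow>
    continuous_on \<Omega> u \<and>
    (\<forall>x0\<in>\<Omega>.
      (\<forall>\<epsilon> K. const_on_ball \<Omega> u x0 \<epsilon> K \<longrightarrow> (\<forall>x\<in>ball x0 \<epsilon>. f x K \<le> 0)) \<and>
      ((\<nexists>\<epsilon> K. const_on_ball \<Omega> u x0 \<epsilon> K) \<longrightarrow>
        (\<forall>\<phi> g H. C2_with \<Omega> \<phi> g H \<longrightarrow>
           (\<forall>\<^sub>F x in nhds x0. u x - \<phi> x \<le> u x0 - \<phi> x0) \<longrightarrow> g x0 \<noteq> 0 \<longrightarrow>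
           f x0 (u x0) \<le> G x0 (g x0) (H x0))))"

definition viscosity_solution ::
    "(real^'n) set \<Rightarrow> (real^'n \<Rightarrow> real^'n \<Rightarrow> real^'n^'n \<Rightarrow> real) \<Rightarrow> (real^'n \<Rightarrow> real \<Rightarrow> real) \<Rightarrow>
     (real^'n \<Rightarrow> real) \<Rightarrow> bool"
  where "viscosity_solution \<Omega> G f u \<longleftrightarrow>
    viscosity_supersolution \<Omega> G f u \<and> viscosity_subsolution \<Omega> G f u"

definition drift_operator ::
    "real \<Rightarrow> (real^'n \<Rightarrow> real^'n \<Rightarrow> real^'n^'n \<Rightarrow> real) \<Rightarrow> (real^'n \<Rightarrow> real^'n) \<Rightarrow>
     real^'n \<Rightarrow> real^'n \<Rightarrow> real^'n^'n \<Rightarrow> real"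
  where "drift_operator \<gamma> F b x p M = F x p M + norm p powr \<gamma> * (b x \<bullet> p)"

definition absorption :: "real \<Rightarrow> (real^'n \<Rightarrow> real) \<Rightarrow> real^'n \<Rightarrow> real \<Rightarrow> real"
  where "absorption \<mu> lam0 x t = lam0 x * t powr \<mu> * (if 0 < t then 1 else 0)"

end

theory Submission
  imports Defs
begin

text \<open>
  Compare the solution with barriers A |x - z|^(2k), where k \<ge> 2 is an integer with
  2k \<ge> \<beta> = (\<gamma> + 2) / (\<gamma> + 1 - \<mu>). Even exponents keep the barrier a polynomial; the natural
  barrier |x - z|^\<beta> need not be C2 at z. For A = c \<rho>^(\<beta> - 2k) with c small, the barrier is a
  strict supersolution in the ball of radius \<rho> away from its centre. If u stays below c \<rho>^\<beta>
  on the ball of radius r = 2\<rho> and u(y) > 0 for some y close to x0, then for every z near y the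
  maximum of u minus the barrier centred at z can therefore only be attained at z, where the
  gradient vanishes and the equation says nothing. Doing this for all z near y gives
  u(x) - u(z) \<le> A |x - z|^(2k), so u is constant near y, and the constancy clause in the
  definition of a subsolution excludes that because u(y) > 0.
\<close>

section \<open>Spectrum and Pucci bound of rank-one perturbations of scalar matrices\<close>

definition outer :: "real^'n \<Rightarrow> real^'n^'n"
  where "outer v = (\<chi> i j. v $ i * v $ j)"

lemma outer_mult: "outer v *v h = (v \<bullet> h) *\<^sub>R v"
  by (simp add: vec_eq_iff outer_def matrix_vector_mult_def inner_vec_def
      sum_distrib_left sum_distrib_right mult_ac)

lemma continuous_on_outer [continuous_intros]:
  fixes f :: "'a::topological_space \<Rightarrow> real^'n"
  assumes "continuous_on S f"
  shows "continuous_on S (\<lambda>x. outer (f x))"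
  unfolding outer_def by (intro continuous_intros assms)

text \<open>Smooth functions of |x - z|^2, in particular the barriers, have Hessians of this shape
  with \<open>v\<close> = x - z.\<close>

definition rank_one_pert :: "real \<Rightarrow> real \<Rightarrow> real^'n \<Rightarrow> real^'n^'n"
  where "rank_one_pert a c v = a *\<^sub>R mat 1 + c *\<^sub>R outer v"

lemma rank_one_pert_mult:
  "rank_one_pert a c v *v h = a *\<^sub>R h + (c * (v \<bullet> h)) *\<^sub>R v"
  by (simp add: rank_one_pert_def matrix_vector_mult_add_rdistrib outer_mult
      flip: scaleR_matrix_vector_assoc)

lemma rank_one_pert_Sym: "rank_one_pert a c v \<in> Sym"
  by (simp add: Sym_def rank_one_pert_def outer_def transpose_def mat_def vec_eq_iff
      mult.commute eq_commute)

lemma psd_rank_one_pert: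
  assumes "0 \<le> a" "0 \<le> c"
  shows "psd (rank_one_pert a c v)"
  using assms by (simp add: psd_def rank_one_pert_mult inner_add_right inner_commute mult.assoc)

text \<open>An eigenvector orthogonal to \<open>v\<close> has eigenvalue \<open>a\<close>. For any
  other eigenvector \<open>w\<close>, pairing the eigenvalue equation with \<open>v\<close> and
  cancelling \<open>v \<bullet> w\<close> gives the second value. The inclusion can be strict: in
  dimension one \<open>a\<close> need not occur.\<close>

lemma eigenvalues_rank_one_pert:
  "eigenvalues (rank_one_pert a c v) \<subseteq> {a, a + c * (v \<bullet> v)}"
proof
  fix e assume "e \<in> eigenvalues (rank_one_pert a c v)"
  then obtain w where "w \<noteq> 0" and w: "a *\<^sub>R w + (c * (v \<bullet> w)) *\<^sub>R v = e *\<^sub>R w"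
    by (auto simp: eigenvalues_def rank_one_pert_mult)
  have eq: "(c * (v \<bullet> w)) *\<^sub>R v = (e - a) *\<^sub>R w"
    using w by (simp add: scaleR_left_diff_distrib algebra_simps)
  have "(a + c * (v \<bullet> v)) * (v \<bullet> w) = e * (v \<bullet> w)"
    using arg_cong[OF w, of "\<lambda>y. v \<bullet> y"] by (simp add: inner_add_right algebra_simps)
  then show "e \<in> {a, a + c * (v \<bullet> v)}"
    using eq \<open>w \<noteq> 0\<close> by (cases "v \<bullet> w = 0") auto
qed

text \<open>There are at most two distinct positive eigenvalues, each at most
  \<open>a + c * (v \<bullet> v)\<close> and of multiplicity at most N. The crude factor 2N avoids
  computing multiplicities. \<open>lam\<close> multiplies only the negative part, which vanishes, so
  the lower ellipticity constant does not enter the final constant.\<close>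

lemma Pucci_plus_rank_one_pert_le:
  fixes v :: "real^'n"
  assumes "0 \<le> a" "0 \<le> c" "0 \<le> Lam"
  shows "Pucci_plus lam Lam (rank_one_pert a c v)
    \<le> 2 * real CARD('n) * Lam * (a + c * (v \<bullet> v))"
proof -
  let ?P = "rank_one_pert a c v" and ?t = "a + c * (v \<bullet> v)"
  have t: "0 \<le> ?t" "a \<le> ?t" using assms by simp_all
  have "{e \<in> eigenvalues ?P. e < 0} = {}"
    using eigenvalues_rank_one_pert[of a c v] t assms(1) by force
  then have neg: "neg_eig_sum ?P = 0" by (simp only: neg_eig_sum_def sum.empty)
  have sub: "{e \<in> eigenvalues ?P. 0 < e} \<subseteq> {a, ?t}"
    using eigenvalues_rank_one_pert[of a c v] by blast
  have card: "card {e \<in> eigenvalues ?P. 0 < e} \<le> 2"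
    using card_mono[OF _ sub] card_insert_le_m1[of 2 "{?t}" a] by simp
  have term_le: "real (eig_mult ?P e) * e \<le> real CARD('n) * ?t"
    if "e \<in> {e \<in> eigenvalues ?P. 0 < e}" for e
  proof (rule mult_mono)
    show "real (eig_mult ?P e) \<le> real CARD('n)"
      unfolding eig_mult_def using dim_subset_UNIV_cart[of "{w. ?P *v w = e *\<^sub>R w}"] by simp
    show "e \<le> ?t" using that sub t by auto
  qed (use that in auto)
  have "pos_eig_sum ?P \<le> real (card {e \<in> eigenvalues ?P. 0 < e}) * (real CARD('n) * ?t)"
    unfolding pos_eig_sum_def by (rule sum_bounded_above) (rule term_le)
  also have "\<dots> \<le> 2 * (real CARD('n) * ?t)"
    using card t by (intro mult_right_mono) auto
  finally have "Lam * pos_eig_sum ?P \<le> Lam * (2 * (real CARD('n) * ?t))"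
    using assms(3) by (rule mult_left_mono)
  then show ?thesis by (simp add: Pucci_plus_def neg mult_ac)
qed

section \<open>Radial barriers and an upper bound for the operator\<close>

text \<open>The exponent is \<open>j + 2\<close> so that the powers left by two differentiations,
  \<open>j + 1\<close> and \<open>j\<close>, need no truncated subtraction.\<close>

lemma C2_with_radial_power:
  fixes z :: "real^'n"
  defines "s \<equiv> \<lambda>x. (x - z) \<bullet> (x - z)"
  shows "C2_with \<Omega> (\<lambda>x. A * s x ^ (j + 2))
    (\<lambda>x. (2 * A * real (j + 2) * s x ^ (j + 1)) *\<^sub>R (x - z))
    (\<lambda>x. rank_one_pert (2 * A * real (j + 2) * s x ^ (j + 1))
       (4 * A * real (j + 2) * real (j + 1) * s x ^ j) (x - z))"
proof -
  have s: "(s has_derivative (\<lambda>h. 2 * ((x - z) \<bullet> h))) (at x)" for x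
    unfolding s_def by (auto intro!: derivative_eq_intros simp: inner_commute)
  have "GDERIV (\<lambda>x. A * s x ^ (j + 2)) x :>
      (2 * A * real (j + 2) * s x ^ (j + 1)) *\<^sub>R (x - z)" for x
    unfolding gderiv_def
    by (rule derivative_eq_intros s refl)+ (auto simp: fun_eq_iff inner_commute algebra_simps)
  moreover have "((\<lambda>x. (2 * A * real (j + 2) * s x ^ (j + 1)) *\<^sub>R (x - z)) has_derivative
      (\<lambda>h. rank_one_pert (2 * A * real (j + 2) * s x ^ (j + 1))
         (4 * A * real (j + 2) * real (j + 1) * s x ^ j) (x - z) *v h)) (at x)" for x
    unfolding rank_one_pert_mult
    by (rule derivative_eq_intros s refl)+ (auto simp: fun_eq_iff algebra_simps)
  moreover have "continuous_on \<Omega> (\<lambda>x. rank_one_pert (2 * A * real (j + 2) * s x ^ (j + 1))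
         (4 * A * real (j + 2) * real (j + 1) * s x ^ j) (x - z))"
    unfolding rank_one_pert_def s_def by (intro continuous_intros)
  ultimately show ?thesis unfolding C2_with_def by blast
qed

text \<open>(F1) controls only increments in the matrix. Starting from the zero matrix, where F
  vanishes, it bounds F itself; Cauchy-Schwarz handles the drift.\<close>

lemma drift_operator_rank_one_pert_le:
  fixes F :: "real^'n \<Rightarrow> real^'n \<Rightarrow> real^'n^'n \<Rightarrow> real"
  assumes "F1 \<Omega> \<gamma> lam Lam F" "x \<in> \<Omega>" "p \<noteq> 0" "F x p 0 = 0" "norm (b x) \<le> B"
    and "0 \<le> a" "0 \<le> c" "0 \<le> Lam"
  shows "drift_operator \<gamma> F b x p (rank_one_pert a c v)
    \<le> norm p powr \<gamma> * (2 * real CARD('n) * Lam * (a + c * (v \<bullet> v)) + B * norm p)"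
proof -
  let ?P = "rank_one_pert a c v"
  have "(0 :: real^'n^'n) \<in> Sym"
    by (simp add: Sym_def transpose_def vec_eq_iff)
  then have "F x p (0 + ?P) - F x p 0 \<le> norm p powr \<gamma> * Pucci_plus lam Lam ?P"
    using assms rank_one_pert_Sym psd_rank_one_pert unfolding F1_def by blast
  then have "F x p ?P \<le> norm p powr \<gamma> * Pucci_plus lam Lam ?P"
    using assms(4) by simp
  also have "\<dots> \<le> norm p powr \<gamma> * (2 * real CARD('n) * Lam * (a + c * (v \<bullet> v)))"
    by (intro mult_left_mono Pucci_plus_rank_one_pert_le assms) simp
  moreover have "b x \<bullet> p \<le> B * norm p"
    using norm_cauchy_schwarz[of "b x" p] mult_right_mono[OF assms(5) norm_ge_zero[of p]] by linarith
  then have "norm p powr \<gamma> * (b x \<bullet> p) \<le> norm p powr \<gamma> * (B * norm p)"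
    by (rule mult_left_mono) simp
  ultimately show ?thesis
    by (simp add: drift_operator_def distrib_left)
qed

section \<open>Local constancy, and its exclusion where u is positive\<close>

text \<open>Exchanging \<open>x\<close> and \<open>z\<close> makes the bound two-sided. An exponent
  of at least 2 then forces the derivative to vanish everywhere on the convex set.\<close>

lemma superlinear_increment_imp_constant:
  fixes u :: "'a::real_normed_vector \<Rightarrow> real"
  assumes "convex S" "2 \<le> n"
    and le: "\<And>x z. x \<in> S \<Longrightarrow> z \<in> S \<Longrightarrow> u x \<le> u z + A * norm (x - z) ^ n"
  shows "\<exists>K. \<forall>x\<in>S. u x = K"
proof -
  have "(u has_derivative (\<lambda>h. 0)) (at z within S)" if "z \<in> S" for z
  proof -
    have bd: "\<bar>u x - u z\<bar> \<le> A * norm (x - z) ^ n" if "x \<in> S" for x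
      using le[OF that \<open>z \<in> S\<close>] le[OF \<open>z \<in> S\<close> that] by (simp add: abs_le_iff norm_minus_commute)
    have "((\<lambda>x. A * norm (x - z) ^ (n - 1)) \<longlongrightarrow> A * norm (z - z) ^ (n - 1)) (at z within S)"
      by (intro tendsto_intros)
    then have lim: "((\<lambda>x. A * norm (x - z) ^ (n - 1)) \<longlongrightarrow> 0) (at z within S)"
      using \<open>2 \<le> n\<close> by (simp add: power_0_left)
    have "((\<lambda>x. (u x - u z) / norm (x - z)) \<longlongrightarrow> 0) (at z within S)"
    proof (rule Lim_null_comparison[OF _ lim])
      have "norm ((u x - u z) / norm (x - z)) \<le> A * norm (x - z) ^ (n - 1)"
        if "x \<in> S" "x \<noteq> z" for x
      proof -
        have "norm (x - z) ^ n = norm (x - z) ^ (n - 1) * norm (x - z)"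
          using \<open>2 \<le> n\<close> by (metis Suc_1 Suc_le_D diff_Suc_1 power_Suc2)
        then show ?thesis
          using bd[OF \<open>x \<in> S\<close>] that by (simp add: divide_le_eq mult.assoc)
      qed
      then show "\<forall>\<^sub>F x in at z within S. norm ((u x - u z) / norm (x - z))
          \<le> A * norm (x - z) ^ (n - 1)"
        by (simp add: eventually_at_filter)
    qed
    then show ?thesis
      by (simp add: has_derivative_within divide_inverse mult.commute)
  qed
  then show ?thesis
    using has_derivative_zero_constant[OF \<open>convex S\<close>] by metis
qed

text \<open>The constancy clause would make the absorption term nonpositive at a positive value.
  This serves twice: it gives access to the test-function clause at a touching point, and it yields
  the final contradiction.\<close>

lemma subsolution_positive_not_const:
  assumes sub: "viscosity_subsolution \<Omega> G (absorption \<mu> lam0) u"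
    and x: "x \<in> \<Omega>" "0 < u x" "0 < lam0 x"
  shows "\<nexists>\<epsilon> K. const_on_ball \<Omega> u x \<epsilon> K"
proof
  assume "\<exists>\<epsilon> K. const_on_ball \<Omega> u x \<epsilon> K"
  then obtain \<epsilon> K where c: "const_on_ball \<Omega> u x \<epsilon> K" by blast
  then have "0 < \<epsilon>" "u x = K" by (auto simp: const_on_ball_def)
  then have "absorption \<mu> lam0 x (u x) \<le> 0"
    using sub x(1) c unfolding viscosity_subsolution_def by (metis centre_in_ball)
  then show False using x by (simp add: absorption_def mult_le_0_iff)
qed

section \<open>Strict supersolution property of the barriers\<close>

text \<open>Put \<delta> = \<gamma> + 1 - \<mu> and e = (n - \<beta>) \<delta>. As \<beta> \<delta>
  = \<gamma> + 2, the power of t on the left is e + n \<mu>. Dividing by (A t^n)^\<mu> leaves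
  c^\<delta> (t/\<rho>)^e D < m, which holds because t \<le> \<rho> and e \<ge> 0; the latter is
  where \<beta> \<le> n enters.\<close>

lemma scaling_inequality:
  fixes \<gamma> \<mu> c D m t \<rho> n :: real
  defines "\<beta> \<equiv> (\<gamma> + 2) / (\<gamma> + 1 - \<mu>)"
  assumes "\<mu> < \<gamma> + 1" "\<beta> \<le> n" "0 < t" "t \<le> \<rho>" "0 < c" "0 \<le> D"
    and cD: "c powr (\<gamma> + 1 - \<mu>) * D < m"
  defines "A \<equiv> c * \<rho> powr (\<beta> - n)"
  shows "A powr (\<gamma> + 1) * t powr ((n - 1) * \<gamma> + n - 2) * D < m * (A * t powr n) powr \<mu>"
proof -
  define \<delta> where "\<delta> = \<gamma> + 1 - \<mu>"
  define e where "e = (n - \<beta>) * \<delta>"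
  have "0 < \<delta>" "0 < \<rho>" using assms by (simp_all add: \<delta>_def)
  then have "0 < A" "0 \<le> e" using assms by (simp_all add: A_def e_def)
  have "\<beta> * \<delta> = \<gamma> + 2" using \<open>0 < \<delta>\<close> by (simp add: \<beta>_def \<delta>_def)
  then have exp: "(n - 1) * \<gamma> + n - 2 = e + n * \<mu>"
    by (simp add: e_def \<delta>_def algebra_simps)
  have Ad: "A powr \<delta> = c powr \<delta> * \<rho> powr (- e)"
    using \<open>0 < c\<close> \<open>0 < \<rho>\<close> by (simp add: A_def powr_mult powr_powr e_def algebra_simps)
  have "t powr e \<le> \<rho> powr e" using assms \<open>0 \<le> e\<close> by (intro powr_mono2) auto
  then have "c powr \<delta> * \<rho> powr (- e) * t powr e \<le> c powr \<delta> * \<rho> powr (- e) * \<rho> powr e"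
    by (intro mult_left_mono) auto
  also have "\<dots> = c powr \<delta>" using \<open>0 < \<rho>\<close> by (simp add: powr_minus)
  finally have "A powr \<delta> * t powr e * D \<le> c powr \<delta> * D"
    using \<open>0 \<le> D\<close> unfolding Ad by (rule mult_right_mono)
  also have "\<dots> < m" using cD by (simp add: \<delta>_def)
  finally have "A powr \<delta> * t powr e * D * (A * t powr n) powr \<mu> < m * (A * t powr n) powr \<mu>"
    using \<open>0 < A\<close> \<open>0 < t\<close> by (intro mult_strict_right_mono) auto
  moreover have "A powr (\<gamma> + 1) = A powr \<delta> * A powr \<mu>"
    by (simp add: \<delta>_def flip: powr_add)
  moreover have "(A * t powr n) powr \<mu> = A powr \<mu> * t powr (n * \<mu>)"
    using \<open>0 < A\<close> by (simp add: powr_mult powr_powr)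
  ultimately show ?thesis
    unfolding exp powr_add by (simp add: mult_ac)
qed

text \<open>With t = |x - z|, the gradient has length 2k A t^(2k-1) and the Hessian contributes
  order A t^(2k-2). \<open>D\<close> collects all factors other than powers of A and t, so the claim
  reduces to \<open>scaling_inequality\<close> with n = 2k.\<close>

lemma radial_power_strict_supersolution:
  fixes F :: "real^'n \<Rightarrow> real^'n \<Rightarrow> real^'n^'n \<Rightarrow> real" and x z :: "real^'n" and j :: nat and \<gamma> \<mu> :: real
  defines "s \<equiv> (x - z) \<bullet> (x - z)"
  defines "k \<equiv> real (j + 2)"
  defines "\<beta> \<equiv> (\<gamma> + 2) / (\<gamma> + 1 - \<mu>)"
  assumes F: "F1 \<Omega> \<gamma> lam Lam F" "F x ((2 * A * k * s ^ (j + 1)) *\<^sub>R (x - z)) 0 = 0"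
    and x: "x \<in> \<Omega>" "x \<noteq> z" "norm (x - z) \<le> \<rho>" "\<rho> \<le> 1"
    and b: "norm (b x) \<le> B"
    and const: "\<mu> < \<gamma> + 1" "\<beta> \<le> 2 * k" "0 < c" "0 \<le> Lam"
    and D: "D = (2 * k) powr \<gamma> * (2 * real CARD('n) * Lam * (2 * k * (2 * k - 1)) + B * (2 * k))"
    and cD: "c powr (\<gamma> + 1 - \<mu>) * D < m"
    and A: "A = c * \<rho> powr (\<beta> - 2 * k)"
  shows "drift_operator \<gamma> F b x ((2 * A * k * s ^ (j + 1)) *\<^sub>R (x - z))
      (rank_one_pert (2 * A * k * s ^ (j + 1)) (4 * A * k * real (j + 1) * s ^ j) (x - z))
    < m * (A * s ^ (j + 2)) powr \<mu>"
proof -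
  define t where "t = norm (x - z)"
  let ?p = "(2 * A * k * s ^ (j + 1)) *\<^sub>R (x - z)"
  have t: "0 < t" "t \<le> \<rho>" "t \<le> 1" using x by (auto simp: t_def)
  have "0 < \<rho>" using t by simp
  have "0 < A" "0 < k" "1 < k" using const \<open>0 < \<rho>\<close> by (simp_all add: A k_def)
  have "0 \<le> B" using b norm_ge_zero order_trans by blast
  have s: "s = t ^ 2" by (simp add: s_def t_def dot_square_norm)
  \<comment> \<open>Natural powers are converted to \<open>powr\<close> for the scaling inequality;
    the shift is 2j = 2k - 4.\<close>
  have pw: "t ^ (2 * j + i) = t powr (2 * k - 4 + i)" for i
    using t by (simp add: k_def flip: powr_realpow)
  have s_powers: "s ^ (j + 1) = t powr (2 * k - 2)" "s ^ (j + 2) = t powr (2 * k)"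
    "s ^ j * t ^ 2 = t powr (2 * k - 2)"
  proof -
    have "s ^ (j + 1) = t ^ (2 * j + 2)" "s ^ (j + 2) = t ^ (2 * j + 4)" "s ^ j * t ^ 2 = t ^ (2 * j + 2)"
      unfolding s power_mult[symmetric] power_add[symmetric] by (simp_all only: distrib_left)
        (simp_all del: power_Suc)
    then show "s ^ (j + 1) = t powr (2 * k - 2)" "s ^ (j + 2) = t powr (2 * k)"
      "s ^ j * t ^ 2 = t powr (2 * k - 2)"
      using pw[of 2] pw[of 4] by simp_all
  qed
  have "t powr (2 * k - 1) = t powr (2 * k - 2) * t"
    using t powr_add[of t "2 * k - 2" 1] by simp
  then have np: "norm ?p = 2 * k * A * t powr (2 * k - 1)"
    unfolding norm_scaleR s_powers(1) t_def[symmetric] using \<open>0 < A\<close> \<open>0 < k\<close> by (simp add: abs_mult)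
  then have "?p \<noteq> 0" using \<open>0 < A\<close> \<open>0 < k\<close> t
    by (metis mult_pos_pos norm_zero less_irrefl powr_gt_zero zero_less_numeral)
  \<comment> \<open>This is the second radial derivative of A t^(2k), the eigenvalue in the
    direction x - z.\<close>
  have tr: "2 * A * k * s ^ (j + 1) + 4 * A * k * real (j + 1) * s ^ j * ((x - z) \<bullet> (x - z))
      = 2 * k * (2 * k - 1) * (A * t powr (2 * k - 2))"
  proof -
    have "real (j + 1) = k - 1" by (simp add: k_def)
    moreover have "s ^ j * s = t powr (2 * k - 2)" using s_powers(3) s by simp
    ultimately have "4 * A * k * real (j + 1) * s ^ j * s = 4 * A * k * (k - 1) * t powr (2 * k - 2)"
      by (simp only: mult.assoc)
    then show ?thesis
      unfolding s_def[symmetric] s_powers(1) by (simp only:) (simp add: algebra_simps)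
  qed
  have "drift_operator \<gamma> F b x ?p
      (rank_one_pert (2 * A * k * s ^ (j + 1)) (4 * A * k * real (j + 1) * s ^ j) (x - z))
    \<le> norm ?p powr \<gamma> * (2 * real CARD('n) * Lam * (2 * k * (2 * k - 1) * (A * t powr (2 * k - 2)))
        + B * norm ?p)"
    unfolding tr[symmetric] using \<open>0 < A\<close> \<open>0 < k\<close> const
    by (intro drift_operator_rank_one_pert_le[where F = F and b = b, OF F(1) x(1) \<open>?p \<noteq> 0\<close> F(2) b]) (auto simp: s_def)
  \<comment> \<open>As t \<le> 1, t^(2k-1) is at most t^(2k-2), so the drift is absorbed into the
    second-order term.\<close>
  also have "\<dots> \<le> norm ?p powr \<gamma> * (2 * real CARD('n) * Lam * (2 * k * (2 * k - 1) * (A * t powr (2 * k - 2)))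
        + B * (2 * k * (A * t powr (2 * k - 2))))"
    using \<open>0 \<le> B\<close> \<open>0 < A\<close> \<open>0 < k\<close> t unfolding np
    by (intro mult_left_mono add_left_mono) (auto intro!: mult_left_mono powr_mono')
  also have "\<dots> = norm ?p powr \<gamma> * (A * t powr (2 * k - 2)) *
      (2 * real CARD('n) * Lam * (2 * k * (2 * k - 1)) + B * (2 * k))"
    by (simp add: algebra_simps)
  also have "norm ?p powr \<gamma> = (2 * k) powr \<gamma> * A powr \<gamma> * t powr ((2 * k - 1) * \<gamma>)"
    using \<open>0 < A\<close> \<open>0 < k\<close> unfolding np by (simp add: powr_mult powr_powr)
  also have "(2 * k) powr \<gamma> * A powr \<gamma> * t powr ((2 * k - 1) * \<gamma>) * (A * t powr (2 * k - 2)) *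
      (2 * real CARD('n) * Lam * (2 * k * (2 * k - 1)) + B * (2 * k))
    = A powr (\<gamma> + 1) * t powr ((2 * k - 1) * \<gamma> + 2 * k - 2) * D"
  proof -
    have "t powr ((2 * k - 1) * \<gamma> + 2 * k - 2) = t powr ((2 * k - 1) * \<gamma>) * t powr (2 * k - 2)"
      by (simp add: add_diff_eq flip: powr_add)
    moreover have "A powr (\<gamma> + 1) = A powr \<gamma> * A" using \<open>0 < A\<close> by (simp add: powr_add)
    ultimately show ?thesis unfolding D by (simp only: mult_ac)
  qed
  also have "\<dots> < m * (A * t powr (2 * k)) powr \<mu>"
  proof -
    have "0 \<le> D" using const \<open>0 \<le> B\<close> \<open>1 < k\<close> by (simp add: D)
    then show ?thesis
      using scaling_inequality[of \<mu> \<gamma> "2 * k" t \<rho> c D m] const t cD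
      unfolding A \<beta>_def by blast
  qed
  finally show ?thesis by (simp only: s_powers)
qed

section \<open>Comparison with a barrier\<close>

text \<open>The maximum of u - \<phi> over the closed ball is at least u(z) > 0, while u - \<phi>
  \<le> 0 on the sphere. An interior maximum off the centre would contradict strictness, so the
  centre is a maximum point. No gradient condition is imposed at \<open>z\<close>.\<close>

lemma subsolution_le_barrier:
  fixes G :: "real^'n \<Rightarrow> real^'n \<Rightarrow> real^'n^'n \<Rightarrow> real"
  assumes sub: "viscosity_subsolution \<Omega> G (absorption \<mu> lam0) u"
    and C2: "C2_with \<Omega> \<phi> g H"
    and ball: "cball z \<rho> \<subseteq> \<Omega>" "0 < \<rho>"
    and phi: "\<phi> z = 0" "\<And>x. 0 \<le> \<phi> x"
    and grad: "\<And>x. x \<in> cball z \<rho> \<Longrightarrow> x \<noteq> z \<Longrightarrow> g x \<noteq> 0"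
    and strict: "\<And>x. x \<in> cball z \<rho> \<Longrightarrow> x \<noteq> z \<Longrightarrow> G x (g x) (H x) < m * \<phi> x powr \<mu>"
    and bdry: "\<And>x. x \<in> sphere z \<rho> \<Longrightarrow> u x \<le> \<phi> x"
    and lam0: "\<And>x. x \<in> \<Omega> \<Longrightarrow> m \<le> lam0 x" "0 < m" "0 \<le> \<mu>"
    and uz: "0 < u z"
    and x: "x \<in> cball z \<rho>"
  shows "u x \<le> u z + \<phi> x"
proof -
  have "continuous_on \<Omega> u" using sub by (simp add: viscosity_subsolution_def)
  moreover have "continuous_on \<Omega> \<phi>"
    using C2 unfolding C2_with_def gderiv_def
    by (auto intro!: continuous_at_imp_continuous_on has_derivative_continuous)
  ultimately have "continuous_on (cball z \<rho>) (\<lambda>x. u x - \<phi> x)"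
    using ball(1) by (intro continuous_on_diff) (auto elim: continuous_on_subset)
  then obtain y where y: "y \<in> cball z \<rho>"
    and max: "\<And>x. x \<in> cball z \<rho> \<Longrightarrow> u x - \<phi> x \<le> u y - \<phi> y"
    using continuous_attains_sup[of "cball z \<rho>" "\<lambda>x. u x - \<phi> x"] ball(2) by auto
  have pos: "\<phi> y < u y" using max[of z] uz phi(1) ball(2) by simp
  have "y = z"
  proof (rule ccontr)
    assume "y \<noteq> z"
    have "y \<in> \<Omega>" "m \<le> lam0 y" using y ball lam0 by auto
    have "dist z y \<noteq> \<rho>" using pos bdry[of y] by auto
    then have "y \<in> ball z \<rho>" using y by simp
    then have "\<forall>\<^sub>F x in nhds y. x \<in> ball z \<rho>"
      by (intro eventually_nhds_in_open) auto
    then have ev: "\<forall>\<^sub>F x in nhds y. u x - \<phi> x \<le> u y - \<phi> y"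
      by eventually_elim (use max in auto)
    \<comment> \<open>The test-function clause applies only where u is not locally constant, which
      u(y) > \<phi>(y) \<ge> 0 guarantees.\<close>
    have "\<nexists>\<epsilon> K. const_on_ball \<Omega> u y \<epsilon> K"
      using pos phi(2)[of y] \<open>m \<le> lam0 y\<close> lam0(2)
      by (intro subsolution_positive_not_const[OF sub \<open>y \<in> \<Omega>\<close>]) auto
    then have "absorption \<mu> lam0 y (u y) \<le> G y (g y) (H y)"
      using sub \<open>y \<in> \<Omega>\<close> C2 ev grad[OF y \<open>y \<noteq> z\<close>] unfolding viscosity_subsolution_def by blast
    also have "\<dots> < m * \<phi> y powr \<mu>" using strict[OF y \<open>y \<noteq> z\<close>] .
    also have "\<dots> \<le> lam0 y * u y powr \<mu>"
      using \<open>m \<le> lam0 y\<close> lam0 pos phi(2)[of y] by (intro mult_mono powr_mono2) auto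
    also have "\<dots> = absorption \<mu> lam0 y (u y)"
      using pos phi(2)[of y] by (simp add: absorption_def)
    finally show False by simp
  qed
  then show ?thesis using max[OF x] phi(1) by simp
qed

section \<open>Non-degeneracy at the closure of the positivity set\<close>

theorem theorem1p1:
  fixes \<gamma> \<mu> Lam m B :: real
  assumes "-1 < \<gamma>" and "0 \<le> \<mu>" and "\<mu> < \<gamma> + 1"
  shows "\<exists>C>0. \<forall>lam (F :: real^'n \<Rightarrow> real^'n \<Rightarrow> real^'n^'n \<Rightarrow> real) b lam0 u.
    0 < lam \<longrightarrow> lam \<le> Lam \<longrightarrow>
    continuous_operator (ball 0 1) F \<longrightarrow>
    F1 (ball 0 1) \<gamma> lam Lam F \<longrightarrow>
    F2 (ball 0 1) \<gamma> F \<longrightarrow>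
    (\<forall>x\<in>ball 0 1. \<forall>p. p \<noteq> 0 \<longrightarrow> F x p 0 = 0) \<longrightarrow>
    continuous_on (cball 0 1) b \<longrightarrow> (SUP x\<in>ball 0 1. norm (b x)) = B \<longrightarrow>
    continuous_on (cball 0 1) lam0 \<longrightarrow> (INF x\<in>ball 0 1. lam0 x) = m \<longrightarrow> 0 < m \<longrightarrow>
    bdd_above (lam0 ` ball 0 1) \<longrightarrow>
    (\<forall>x\<in>ball 0 1. 0 \<le> u x) \<longrightarrow> bounded (u ` ball 0 1) \<longrightarrow>
    viscosity_solution (ball 0 1) (drift_operator \<gamma> F b) (absorption \<mu> lam0) u \<longrightarrow>
    (\<forall>x0 \<in> closure {x \<in> ball 0 1. 0 < u x} \<inter> ball 0 (1/2). \<forall>r. 0 < r \<and> r < 1/2 \<longrightarrow>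
      (SUP x\<in>ball x0 r. u x) \<ge> C * r powr ((\<gamma> + 2) / (\<gamma> + 1 - \<mu>)))"
proof (cases "0 < m \<and> 0 < Lam")
  \<comment> \<open>No data satisfy the hypotheses, so any positive constant will do.\<close>
  case False
  then show ?thesis by (intro exI[of _ 1]) auto
next
  case True
  then have "0 < m" "0 < Lam" by auto
  define \<beta> where "\<beta> = (\<gamma> + 2) / (\<gamma> + 1 - \<mu>)"
  obtain j :: nat where "\<beta> \<le> real j" using real_arch_simple by blast
  define k where "k = real (j + 2)"
  have k: "\<beta> \<le> 2 * k" "1 < k" using \<open>\<beta> \<le> real j\<close> by (auto simp: k_def)
  \<comment> \<open>The absolute value keeps \<open>D\<close> positive before \<open>B\<close> is
    known to be a supremum of norms.\<close>
  define D where "D = (2 * k) powr \<gamma> *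
    (2 * real CARD('n) * Lam * (2 * k * (2 * k - 1)) + \<bar>B\<bar> * (2 * k))"
  have "0 < D" unfolding D_def using k \<open>0 < Lam\<close>
    by (intro mult_pos_pos add_pos_nonneg) auto
  \<comment> \<open>Solves c^(\<gamma> + 1 - \<mu>) D = m/2; the half leaves room for strictness.
    Only N, \<open>Lam\<close>, \<open>m\<close>, \<open>B\<close>, \<gamma> and \<mu> have entered
    so far.\<close>
  define c where "c = (m / (2 * D)) powr (1 / (\<gamma> + 1 - \<mu>))"
  have "0 < c" using \<open>0 < m\<close> \<open>0 < D\<close> by (simp add: c_def)
  have "c powr (\<gamma> + 1 - \<mu>) = m / (2 * D)"
    using assms \<open>0 < m\<close> \<open>0 < D\<close> by (simp add: c_def powr_powr)
  then have cD: "c powr (\<gamma> + 1 - \<mu>) * D < m"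
    using \<open>0 < m\<close> \<open>0 < D\<close> by simp
  show ?thesis
  \<comment> \<open>The factor (1/2)^\<beta> pays for barriers of radius \<rho> = r/2, whose centres
    can then move within B_r(x0).\<close>
  proof (intro exI[of _ "c * (1/2) powr \<beta>"] conjI allI impI ballI)
    show "0 < c * (1/2) powr \<beta>" using \<open>0 < c\<close> by simp
  next
    fix lam r :: real and b lam0 u and x0 :: "real^'n"
    fix F :: "real^'n \<Rightarrow> real^'n \<Rightarrow> real^'n^'n \<Rightarrow> real"
    let ?\<Omega> = "ball (0 :: real^'n) 1"
    assume F: "F1 ?\<Omega> \<gamma> lam Lam F" "\<forall>x\<in>?\<Omega>. \<forall>p. p \<noteq> 0 \<longrightarrow> F x p 0 = 0"
      and b: "continuous_on (cball 0 1) b" "(SUP x\<in>?\<Omega>. norm (b x)) = B"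
      and lam0: "continuous_on (cball 0 1) lam0" "(INF x\<in>?\<Omega>. lam0 x) = m"
      and u: "\<forall>x\<in>?\<Omega>. 0 \<le> u x" "bounded (u ` ?\<Omega>)"
      and sol: "viscosity_solution ?\<Omega> (drift_operator \<gamma> F b) (absorption \<mu> lam0) u"
      and x0: "x0 \<in> closure {x \<in> ?\<Omega>. 0 < u x} \<inter> ball 0 (1/2)"
      and r: "0 < r \<and> r < 1/2"
    have sub: "viscosity_subsolution ?\<Omega> (drift_operator \<gamma> F b) (absorption \<mu> lam0) u"
      using sol by (simp add: viscosity_solution_def)
    have b_le: "norm (b x) \<le> \<bar>B\<bar>" if "x \<in> ?\<Omega>" for x
    proof -
      have "bounded (b ` cball 0 1)"
        using b(1) compact_cball compact_continuous_image compact_imp_bounded by blast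
      then have "bdd_above ((\<lambda>x. norm (b x)) ` ?\<Omega>)"
        unfolding bounded_iff by (force intro: bdd_aboveI2)
      then show ?thesis using cSUP_upper[OF that] b(2) by fastforce
    qed
    have lam0_ge: "m \<le> lam0 x" if "x \<in> ?\<Omega>" for x
    proof -
      have "bounded (lam0 ` cball 0 1)"
        using lam0(1) compact_cball compact_continuous_image compact_imp_bounded by blast
      then have "bdd_below (lam0 ` ?\<Omega>)"
        by (meson ball_subset_cball bdd_below_mono bounded_imp_bdd_below image_mono)
      then show ?thesis using cINF_lower[OF _ that] lam0(2) by blast
    qed
    have ball_r: "ball x0 r \<subseteq> ?\<Omega>"
    proof
      fix x assume "x \<in> ball x0 r"
      then show "x \<in> ?\<Omega>" using x0 r norm_triangle_ineq[of x0 "x - x0"]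
        by (auto simp: dist_norm norm_minus_commute)
    qed
    show "c * (1/2) powr \<beta> * r powr ((\<gamma> + 2) / (\<gamma> + 1 - \<mu>)) \<le> (SUP x\<in>ball x0 r. u x)"
    proof (rule ccontr)
      assume "\<not> ?thesis"
      then have small: "(SUP x\<in>ball x0 r. u x) < c * (1/2) powr \<beta> * r powr \<beta>"
        by (simp add: \<beta>_def)
      define \<rho> where "\<rho> = r / 2"
      have \<rho>: "0 < \<rho>" "\<rho> \<le> 1" using r by (auto simp: \<rho>_def)
      \<comment> \<open>Normalised so that the barrier equals c \<rho>^\<beta> on the sphere of
        radius \<rho>, which is above u by the assumed smallness.\<close>
      define A where "A = c * \<rho> powr (\<beta> - 2 * k)"
      have "0 < A" using \<open>0 < c\<close> \<rho> by (simp add: A_def)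
      have "\<rho> ^ (2 * (j + 2)) = \<rho> powr (2 * k)"
        unfolding k_def using powr_realpow[OF \<rho>(1), of "2 * (j + 2)"]
        by (simp only: of_nat_mult of_nat_numeral)
      then have "\<rho> powr (\<beta> - 2 * k) * \<rho> ^ (2 * (j + 2)) = \<rho> powr (\<beta> - 2 * k) * \<rho> powr (2 * k)"
        by simp
      also have "\<dots> = \<rho> powr \<beta>" by (simp flip: powr_add)
      finally have A\<rho>: "A * \<rho> ^ (2 * (j + 2)) = c * \<rho> powr \<beta>"
        by (simp add: A_def mult.assoc)
      have u_le: "u x \<le> A * \<rho> ^ (2 * (j + 2))" if "x \<in> ball x0 r" for x
      proof -
        have "bdd_above (u ` ball x0 r)"
          using u(2) ball_r by (meson bdd_above_mono bounded_imp_bdd_above image_mono)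
        then have "u x < c * (1/2) powr \<beta> * r powr \<beta>"
          using cSUP_upper[OF that] small by fastforce
        also have "\<dots> = c * \<rho> powr \<beta>"
          using r by (simp add: \<rho>_def flip: powr_mult)
        finally show ?thesis using A\<rho> by simp
      qed
      \<comment> \<open>u may vanish at \<open>x0\<close> itself. The distance r/4 leaves room for a
        shift of the centre by less than r/4 and the radius r/2, inside B_r(x0).\<close>
      obtain y where y: "y \<in> ?\<Omega>" "0 < u y" "dist y x0 < r / 4"
        using x0 r by (auto simp: closure_approachable dest!: spec[of _ "r / 4"])
      have "continuous_on ?\<Omega> u" using sub by (simp add: viscosity_subsolution_def)
      then have "isCont u y" using y(1) by (simp add: continuous_on_eq_continuous_at)
      then have "\<forall>\<^sub>F x in nhds y. 0 < u x"
        using y(2) by (simp add: isCont_def tendsto_at_iff_tendsto_nhds order_tendstoD)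
      then obtain d where "0 < d" and d: "\<And>x. dist x y < d \<Longrightarrow> 0 < u x"
        unfolding eventually_nhds_metric by blast
      define \<eta> where "\<eta> = min d (r / 4)"
      have "0 < \<eta>" using \<open>0 < d\<close> r by (simp add: \<eta>_def)
      have near: "0 < u z" "cball z \<rho> \<subseteq> ball x0 r" if "z \<in> ball y \<eta>" for z
      proof -
        show "0 < u z" using that d by (simp add: \<eta>_def dist_commute)
        show "cball z \<rho> \<subseteq> ball x0 r"
        proof
          fix w assume "w \<in> cball z \<rho>"
          then have "dist z w \<le> r / 2" "dist y z < r / 4"
            using that by (auto simp: \<rho>_def \<eta>_def)
          then show "w \<in> ball x0 r"
            using y(3) dist_triangle[of x0 w y] dist_triangle[of y w z] by (simp add: dist_commute)
        qed
      qed
      \<comment> \<open>Both points range over the same ball, so their roles can be exchanged. Its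
        radius \<eta> \<le> r/4 puts \<open>x\<close> within \<rho> of \<open>z\<close>.\<close>
      have touch: "u x \<le> u z + A * norm (x - z) ^ (2 * (j + 2))"
        if x: "x \<in> ball y \<eta>" and z: "z \<in> ball y \<eta>" for x z
      proof -
        let ?s = "\<lambda>x. (x - z) \<bullet> (x - z)"
        have s_pow: "?s x ^ i = norm (x - z) ^ (2 * i)" for x i
          by (simp add: dot_square_norm power_mult)
        have in\<Omega>: "cball z \<rho> \<subseteq> ?\<Omega>" using near(2)[OF z] ball_r by blast
        have "u x \<le> u z + A * ?s x ^ (j + 2)"
        proof (rule subsolution_le_barrier[OF sub C2_with_radial_power in\<Omega> \<rho>(1) _ _ _ _ _
              lam0_ge \<open>0 < m\<close> assms(2) near(1)[OF z]])
          show "0 \<le> A * ?s w ^ (j + 2)" for w using \<open>0 < A\<close> by simp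
          show grad: "(2 * A * real (j + 2) * ?s w ^ (j + 1)) *\<^sub>R (w - z) \<noteq> 0" if "w \<noteq> z" for w
            using that \<open>0 < A\<close> by simp
          show "drift_operator \<gamma> F b w ((2 * A * real (j + 2) * ?s w ^ (j + 1)) *\<^sub>R (w - z))
              (rank_one_pert (2 * A * real (j + 2) * ?s w ^ (j + 1))
                (4 * A * real (j + 2) * real (j + 1) * ?s w ^ j) (w - z))
              < m * (A * ?s w ^ (j + 2)) powr \<mu>"
            if "w \<in> cball z \<rho>" "w \<noteq> z" for w
          proof (rule radial_power_strict_supersolution[where \<gamma> = \<gamma> and \<rho> = \<rho> and c = c and D = D])
            show "w \<in> ?\<Omega>" using that in\<Omega> by blast
            then show "F w ((2 * A * real (j + 2) * ?s w ^ (j + 1)) *\<^sub>R (w - z)) 0 = 0"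
              using F(2) grad[OF that(2)] by blast
            show "norm (b w) \<le> \<bar>B\<bar>" using b_le \<open>w \<in> ?\<Omega>\<close> .
            show "norm (w - z) \<le> \<rho>" using that by (simp add: dist_norm norm_minus_commute)
          qed (use F(1) that \<rho> assms k \<open>0 < c\<close> \<open>0 < Lam\<close> cD
               in \<open>simp_all only: D_def A_def k_def \<beta>_def less_imp_le simp_thms\<close>)
          show "u w \<le> A * ?s w ^ (j + 2)" if "w \<in> sphere z \<rho>" for w
          proof -
            have "w \<in> ball x0 r" using that near(2)[OF z] sphere_cball by blast
            moreover have "norm (w - z) = \<rho>"
              using that by (simp add: dist_norm norm_minus_commute)
            ultimately show ?thesis using u_le[of w] unfolding s_pow by simp
          qed
          have "dist z x \<le> dist z y + dist y x" by (rule dist_triangle)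
          then show "x \<in> cball z \<rho>"
            using x z by (auto simp: \<eta>_def \<rho>_def dist_commute)
        qed auto
        then show ?thesis unfolding s_pow .
      qed
      obtain K where K: "\<forall>x\<in>ball y \<eta>. u x = K"
        using superlinear_increment_imp_constant[OF convex_ball _ touch, of y \<eta>] by auto
      have "ball y \<eta> \<subseteq> ?\<Omega>"
        using near(2) ball_r \<rho>(1) by (meson centre_in_cball less_imp_le subset_iff)
      then have "const_on_ball ?\<Omega> u y \<eta> K"
        using K \<open>0 < \<eta>\<close> by (simp add: const_on_ball_def)
      moreover have "0 < lam0 y" using lam0_ge[OF y(1)] \<open>0 < m\<close> by simp
      ultimately show False
        using subsolution_positive_not_const[OF sub y(1,2)] by blast
    qed
  qed
qed

end
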